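(* Let $(A,\mathrm{Pr})$ be a finitary probability space, let $n\in\mathbb{N}$, let $t$ and $u$ be Boolean terms in $T[x_1,\dots,x_n]$, and let $a_1,\dots,a_{2n}\in A$ be events such that the events $a_1,\dots,a_n$ are independent of the events $a_{n+1},\dots,a_{2n}$. Then the two events $$a:=\Phi_A[t;\,a_1,\dots,a_n]\quad\text{and}\quad b:=\Phi_A[u;\,a_{n+1},\dots,a_{2n}]$$ are independent, that is, $\mathrm{Pr}(a\wedge b)=\mathrm{Pr}(a)\,\mathrm{Pr}(b)$.
   Context: $\mathbb{N}=\{1,2,\dots\}$. A finitary probability space is a pair $(A,\mathrm{Pr})$ of a Boolean algebra $A=(A,\vee,\wedge,{}^c,0_A,1_A)$ (with $0_A\ne1_A$) and a map $\mathrm{Pr}\colon A\to[0,1]$ such that $\mathrm{Pr}(0_A)=0$, $\mathrm{Pr}(1_A)=1$ and $\mathrm{Pr}(a\vee b)=\mathrm{Pr}(a)+\mathrm{Pr}(b)-\mathrm{Pr}(a\wedge b)$ for all $a,b\in A$. Elements of $A$ are called events. Independence of tuples: finite tuples of events $a_i$, $i\in I$, and $b_i$, $i\in J$: the former are independent of the latter if for all subsets $X\subset I$ and $Y\subset J$ one has $\mathrm{Pr}\big(\bigwedge_{i\in X}a_i\wedge\bigwedge_{i\in Y}b_i\big)=\mathrm{Pr}\big(\bigwedge_{i\in X}a_i\big)\mathrm{Pr}\big(\bigwedge_{i\in Y}b_i\big)$, where an empty meet is $1_A$. Boolean terms: words built from variables $x_1,x_2,\dots$, symbols $\vee,\wedge,\neg,0,1$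 and brackets by the rules: $0$, $1$ and each variable are terms; if $t,u$ are terms then $\neg(t)$, $(t\vee u)$, $(t\wedge u)$ are terms. $T[x_1,\dots,x_n]$ is the set of terms using only variables among $x_1,\dots,x_n$. Evaluation: for $t\in T[x_1,\dots,x_n]$ and $\overline{b}=(b_1,\dots,b_n)\in A^n$, $\Phi_A[t;\overline{b}]\in A$ is defined recursively by $\Phi_A[0;\overline{b}]=0_A$, $\Phi_A[1;\overline{b}]=1_A$, $\Phi_A[x_i;\overline{b}]=b_i$, $\Phi_A[\neg(t);\overline{b}]=\Phi_A[t;\overline{b}]^c$, $\Phi_A[(t\vee u);\overline{b}]=\Phi_A[t;\overline{b}]\vee\Phi_A[u;\overline{b}]$, $\Phi_A[(t\wedge u);\overline{b}]=\Phi_A[t;\overline{b}]\wedge\Phi_A[u;\overline{b}]$. *)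

theory Defs
  imports Complex_Main
begin

text \<open>The Boolean algebra is the whole type \<open>'a\<close>; the operations $\vee$, $\wedge$, ${}^c$, $0_A$, $1_A$
  are the library's \<^term>\<open>sup\<close>, \<^term>\<open>inf\<close>, \<^term>\<open>uminus\<close>, \<^term>\<open>bot\<close>, \<^term>\<open>top\<close>.
  The class \<open>boolean_algebra\<close> admits the one-element algebra, so $0_A \neq 1_A$ is required
  separately.\<close>

locale finitary_probability_space =
  fixes Pr :: "'a::boolean_algebra \<Rightarrow> real"
  assumes bot_neq_top: "(bot::'a) \<noteq> top"
    and Pr_range: "Pr a \<in> {0..1}"
    and Pr_bot: "Pr bot = 0"
    and Pr_top: "Pr top = 1"
    and Pr_sup: "Pr (sup a b) = Pr a + Pr b - Pr (inf a b)"

text \<open>\<open>finite_meet a X\<close> is the meet of the events \<open>a i\<close> for \<open>i \<in> X\<close>, with value \<^term>\<open>top\<close> if \<open>X\<close> is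
  empty. It is only meaningful for finite \<open>X\<close>, as for \<^term>\<open>sum\<close> and \<^term>\<open>prod\<close>.\<close>

global_interpretation inf_set: comm_monoid_set inf "top :: 'a::boolean_algebra"
  defines finite_meet = inf_set.F
  by standard simp_all

definition independent_tuples ::
    "('a::boolean_algebra \<Rightarrow> real) \<Rightarrow> 'i set \<Rightarrow> ('i \<Rightarrow> 'a) \<Rightarrow> 'j set \<Rightarrow> ('j \<Rightarrow> 'a) \<Rightarrow> bool" where
  "independent_tuples Pr I a J b \<longleftrightarrow> finite I \<and> finite J \<and>
     (\<forall>X Y. X \<subseteq> I \<longrightarrow> Y \<subseteq> J \<longrightarrow>
        Pr (inf (finite_meet a X) (finite_meet b Y)) = Pr (finite_meet a X) * Pr (finite_meet b Y))"

text \<open>Fully bracketed words are represented by their syntax trees. The variables of the theory are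
  \<open>BVar i\<close> with \<open>i \<ge> 1\<close>; the superfluous \<open>BVar 0\<close> lies in no \<open>bterms_upto n\<close>.\<close>

datatype bterm =
    BZero
  | BOne
  | BVar nat
  | BNot bterm
  | BOr bterm bterm
  | BAnd bterm bterm

primrec bterm_vars :: "bterm \<Rightarrow> nat set" where
  "bterm_vars BZero = {}"
| "bterm_vars BOne = {}"
| "bterm_vars (BVar i) = {i}"
| "bterm_vars (BNot t) = bterm_vars t"
| "bterm_vars (BOr t u) = bterm_vars t \<union> bterm_vars u"
| "bterm_vars (BAnd t u) = bterm_vars t \<union> bterm_vars u"

text \<open>$T[x_1,\dots,x_n]$\<close>

definition bterms_upto :: "nat \<Rightarrow> bterm set" where
  "bterms_upto n = {t. bterm_vars t \<subseteq> {1..n}}"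

text \<open>$\Phi_A[t; b_1,\dots,b_n]$, where the tuple is given by a function on indices of which only the
  values at $1,\dots,n$ matter when \<open>t \<in> bterms_upto n\<close>.\<close>

primrec bterm_eval :: "bterm \<Rightarrow> (nat \<Rightarrow> 'a::boolean_algebra) \<Rightarrow> 'a" where
  "bterm_eval BZero b = bot"
| "bterm_eval BOne b = top"
| "bterm_eval (BVar i) b = b i"
| "bterm_eval (BNot t) b = - bterm_eval t b"
| "bterm_eval (BOr t u) b = sup (bterm_eval t b) (bterm_eval u b)"
| "bterm_eval (BAnd t u) b = inf (bterm_eval t b) (bterm_eval u b)"

end

(* Independence of an event e passes from a family M of events closed under meets to the Boolean
   algebra generated by M. Splitting along one variable x of t (Shannon expansion) gives
   Pr(t & m) = Pr(t[x:=1] & x & m) + Pr(t[x:=0] & m) - Pr(t[x:=0] & x & m), so the variables of t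
   can be moved one by one into the meet m of elements of M. Using this once for each of the two
   tuples proves the theorem. *)

theory Submission
  imports Defs
begin

lemma finite_meet_insert:
  assumes "finite X"
  shows "finite_meet a (insert i X) = inf (a i) (finite_meet a X)"
proof (cases "i \<in> X")
  case True
  then have "finite_meet a X = inf (a i) (finite_meet a (X - {i}))"
    using assms by (rule inf_set.remove[rotated])
  with True show ?thesis
    by (simp add: insert_absorb)
qed (simp add: assms)

text \<open>Idempotence of \<open>inf\<close> absorbs common indices. Hence the meets of subtuples
  of a fixed finite tuple are closed under \<open>inf\<close>.\<close>

lemma finite_meet_Un:
  assumes "finite X" "finite Y"
  shows "finite_meet a (X \<union> Y) = inf (finite_meet a X) (finite_meet a Y)"
  using assms by (induction X) (simp_all add: finite_meet_insert inf_assoc del: inf_set.insert)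

lemma inf_uminus_cong:
  fixes x :: "'a::boolean_algebra"
  assumes "inf x c = inf y c"
  shows "inf (- x) c = inf (- y) c"
proof -
  have "inf (- z) c = inf (- inf z c) c" for z
    by (simp add: inf_sup_distrib2)
  with assms show ?thesis by metis
qed

text \<open>Meeting with \<open>c\<close> is a Boolean homomorphism onto the algebra of elements
  below \<open>c\<close>, so below \<open>c\<close> only the traces of the values on
  \<open>c\<close> count. Below \<open>b i\<close> the value \<open>b i\<close> may thus become
  \<open>top\<close>, and below \<open>- b i\<close> it may become \<open>bot\<close>.\<close>

lemma bterm_eval_inf_cong:
  assumes "\<And>i. i \<in> bterm_vars t \<Longrightarrow> inf (b i) c = inf (b' i) c"
  shows "inf (bterm_eval t b) c = inf (bterm_eval t b') c"
  using assms
proof (induction t)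
  case (BNot t)
  then have "inf (bterm_eval t b) c = inf (bterm_eval t b') c" by simp
  then show ?case by (simp only: bterm_eval.simps) (rule inf_uminus_cong)
next
  case (BOr t u)
  then show ?case by (simp add: inf_sup_distrib2)
next
  case (BAnd t u)
  then have "inf (bterm_eval t b) c = inf (bterm_eval t b') c"
    and "inf (bterm_eval u b) c = inf (bterm_eval u b') c" by simp_all
  then show ?case by (metis bterm_eval.simps(6) inf_assoc inf_left_commute)
qed simp_all

lemma bterm_eval_bot_top:
  assumes "\<And>i. i \<in> bterm_vars t \<Longrightarrow> b i \<in> {bot, top}"
  shows "bterm_eval t b \<in> {bot, top}"
  using assms
proof (induction t)
  case (BOr t u)
  then have "bterm_eval t b \<in> {bot, top}" "bterm_eval u b \<in> {bot, top}" by simp_all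
  then show ?case by auto
next
  case (BAnd t u)
  then have "bterm_eval t b \<in> {bot, top}" "bterm_eval u b \<in> {bot, top}" by simp_all
  then show ?case by auto
next
  case (BNot t)
  then have "bterm_eval t b \<in> {bot, top}" by simp
  then show ?case by auto
qed simp_all

context finitary_probability_space
begin

lemma Pr_split: "Pr x = Pr (inf x y) + Pr (inf x (- y))"
proof -
  have "x = sup (inf x y) (inf x (- y))"
    by (simp flip: inf_sup_distrib1)
  moreover have "inf (inf x y) (inf x (- y)) = bot"
    by (metis inf_assoc inf_compl_bot_right inf_commute)
  ultimately show ?thesis
    using Pr_sup[of "inf x y" "inf x (- y)"] by (simp add: Pr_bot)
qed

text \<open>Shannon expansion along variable \<open>i\<close>. The part below \<open>- b i\<close>
  is written as a difference, so that only \<open>b i\<close> itself is met with \<open>c\<close>: a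
  family closed under meets may lack complements.\<close>

lemma Pr_bterm_eval_split:
  "Pr (inf (bterm_eval t b) c) =
     Pr (inf (bterm_eval t (b(i := top))) (inf (b i) c)) +
     Pr (inf (bterm_eval t (b(i := bot))) c) -
     Pr (inf (bterm_eval t (b(i := bot))) (inf (b i) c))"
proof -
  have 1: "inf (bterm_eval t b) (inf (b i) c) = inf (bterm_eval t (b(i := top))) (inf (b i) c)"
    by (rule bterm_eval_inf_cong) simp
  have 2: "inf (bterm_eval t b) (inf (- b i) c) = inf (bterm_eval t (b(i := bot))) (inf (- b i) c)"
    by (rule bterm_eval_inf_cong) (auto simp flip: inf_assoc)
  have split: "Pr (inf x c) = Pr (inf x (inf (b i) c)) + Pr (inf x (inf (- b i) c))" for x
    using Pr_split[of "inf x c" "b i"] by (simp add: ac_simps)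
  show ?thesis
    using split[of "bterm_eval t b"] split[of "bterm_eval t (b(i := bot))"] by (simp add: 1 2)
qed

text \<open>Induction on the set \<open>V\<close> of variables not yet replaced by constants. The
  extra factor \<open>m\<close> collects the events split off, and so must vary in the
  induction.\<close>

lemma bterm_eval_indep_meet:
  assumes M_inf: "\<And>x y. x \<in> M \<Longrightarrow> y \<in> M \<Longrightarrow> inf x y \<in> M"
    and M_indep: "\<And>m. m \<in> M \<Longrightarrow> Pr (inf m e) = Pr m * Pr e"
    and "finite V"
    and "\<And>i. i \<in> V \<Longrightarrow> b i \<in> M"
    and "\<And>i. i \<in> bterm_vars t - V \<Longrightarrow> b i \<in> {bot, top}"
    and "m \<in> M"
  shows "Pr (inf (bterm_eval t b) (inf m e)) = Pr (inf (bterm_eval t b) m) * Pr e"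
  using assms(3-)
proof (induction V arbitrary: b m)
  case empty
  \<comment> \<open>All variables are now constants: for \<open>bot\<close> both sides vanish, for
    \<open>top\<close> the claim is \<open>M_indep\<close> at \<open>m\<close>.\<close>
  then have "bterm_eval t b \<in> {bot, top}"
    by (intro bterm_eval_bot_top) auto
  with M_indep[OF \<open>m \<in> M\<close>] show ?case
    by (auto simp: Pr_bot)
next
  case (insert i V)
  \<comment> \<open>As \<open>i \<notin> V\<close>, the update keeps the values on \<open>V\<close>
    in \<open>M\<close> and makes \<open>i\<close> a constant. It is applied with \<open>m'\<close>
    equal to \<open>m\<close> and to \<open>inf (b i) m\<close>.\<close>
  have IH: "Pr (inf (bterm_eval t (b(i := z))) (inf m' e)) =
      Pr (inf (bterm_eval t (b(i := z))) m') * Pr e"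
    if "z \<in> {bot, top}" "m' \<in> M" for z m'
    using that insert.prems insert.hyps by (intro insert.IH) auto
  have M: "m \<in> M" "inf (b i) m \<in> M"
    using insert.prems by (simp_all add: M_inf)
  let ?t = "\<lambda>z. bterm_eval t (b(i := z))"
  have "Pr (inf (bterm_eval t b) (inf m e)) =
      Pr (inf (?t top) (inf (inf (b i) m) e)) + Pr (inf (?t bot) (inf m e)) -
      Pr (inf (?t bot) (inf (inf (b i) m) e))"
    using Pr_bterm_eval_split[of t b "inf m e" i] by (simp only: inf_assoc)
  also have "\<dots> = (Pr (inf (?t top) (inf (b i) m)) + Pr (inf (?t bot) m) -
      Pr (inf (?t bot) (inf (b i) m))) * Pr e"
    using M by (simp only: IH insert_iff simp_thms left_diff_distrib distrib_right)
  also have "\<dots> = Pr (inf (bterm_eval t b) m) * Pr e"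
    by (simp only: Pr_bterm_eval_split[of t b m i])
  finally show ?case .
qed

lemma bterm_eval_indep:
  assumes "\<And>x y. x \<in> M \<Longrightarrow> y \<in> M \<Longrightarrow> inf x y \<in> M"
    and "\<And>m. m \<in> M \<Longrightarrow> Pr (inf m e) = Pr m * Pr e"
    and "top \<in> M"
    and "finite V" "bterm_vars t \<subseteq> V"
    and "\<And>i. i \<in> V \<Longrightarrow> b i \<in> M"
  shows "Pr (inf (bterm_eval t b) e) = Pr (bterm_eval t b) * Pr e"
  using bterm_eval_indep_meet[of M e V b t top] assms by auto

text \<open>Here \<open>M\<close> consists of all meets of subtuples of \<open>a\<close>:
  \<open>top\<close> is the empty meet, and each \<open>a j\<close> is a singleton meet. Keeping
  \<open>b\<close> apart from \<open>a\<close> allows a shifted indexing of the same events.\<close>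

lemma bterm_eval_indep_finite_meet:
  assumes "finite I"
    and "\<And>X. X \<subseteq> I \<Longrightarrow> Pr (inf (finite_meet a X) e) = Pr (finite_meet a X) * Pr e"
    and "finite V" "bterm_vars t \<subseteq> V"
    and "\<And>i. i \<in> V \<Longrightarrow> b i \<in> a ` I"
  shows "Pr (inf (bterm_eval t b) e) = Pr (bterm_eval t b) * Pr e"
proof (rule bterm_eval_indep[where M = "finite_meet a ` Pow I"])
  show "inf x y \<in> finite_meet a ` Pow I"
    if "x \<in> finite_meet a ` Pow I" "y \<in> finite_meet a ` Pow I" for x y
  proof -
    from that obtain X Y where "X \<subseteq> I" "x = finite_meet a X" "Y \<subseteq> I" "y = finite_meet a Y"
      by auto
    with \<open>finite I\<close> have "inf x y = finite_meet a (X \<union> Y)" "X \<union> Y \<in> Pow I"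
      by (auto simp: finite_meet_Un finite_subset)
    then show ?thesis by blast
  qed
  show "top \<in> finite_meet a ` Pow I"
    by (rule image_eqI[of _ _ "{}"]) simp_all
  show "b i \<in> finite_meet a ` Pow I" if "i \<in> V" for i
  proof -
    from assms(5)[OF that] obtain j where "j \<in> I" "b i = a j" by auto
    then show ?thesis
      by (intro image_eqI[of _ _ "{j}"]) simp_all
  qed
qed (use assms in auto)

end

theorem theorem8p5:
  fixes Pr :: "'a::boolean_algebra \<Rightarrow> real"
    and n :: nat
    and t u :: bterm
    and a :: "nat \<Rightarrow> 'a"
  assumes "finitary_probability_space Pr"
    and "n \<ge> 1"
    and "t \<in> bterms_upto n"
    and "u \<in> bterms_upto n"
    and "independent_tuples Pr {1..n} a {n+1..2*n} a"
  shows "Pr (inf (bterm_eval t a) (bterm_eval u (\<lambda>i. a (n + i))))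
       = Pr (bterm_eval t a) * Pr (bterm_eval u (\<lambda>i. a (n + i)))"
proof -
  interpret finitary_probability_space Pr by fact
  let ?b = "\<lambda>i. a (n + i)"
  have vars: "bterm_vars t \<subseteq> {1..n}" "bterm_vars u \<subseteq> {1..n}"
    using assms(3,4) by (simp_all add: bterms_upto_def)
  \<comment> \<open>First use: \<open>e\<close> is a meet from the second tuple.\<close>
  have "Pr (inf (bterm_eval t a) (finite_meet a Y)) = Pr (bterm_eval t a) * Pr (finite_meet a Y)"
    if "Y \<subseteq> {n+1..2*n}" for Y
    by (rule bterm_eval_indep_finite_meet[of "{1..n}" a _ "{1..n}"])
      (use assms(5) vars that in \<open>auto simp: independent_tuples_def\<close>)
  \<comment> \<open>Second use, with the roles exchanged: \<open>e\<close> is now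
    \<open>bterm_eval t a\<close>, and the previous equality supplies its independence of all meets
    from the second tuple.\<close>
  then have "Pr (inf (bterm_eval u ?b) (bterm_eval t a)) = Pr (bterm_eval u ?b) * Pr (bterm_eval t a)"
    by (intro bterm_eval_indep_finite_meet[of "{n+1..2*n}" a _ "{1..n}"])
      (use vars in \<open>auto simp: inf_commute mult.commute\<close>)
  then show ?thesis
    by (simp add: inf_commute mult.commute)
qed

end
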